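(* Let $\alpha>-1$ and $t\in\mathbb{R}$ be fixed. The recurrence coefficient $\beta_n=\beta_n(t)$ has a large $n$ asymptotic expansion $$\beta_n=\frac14+\sum_{j=1}^{\infty}\frac{a_j}{n^j},\qquad n\to\infty,$$ (that is, there are numbers $a_j=a_j(\alpha,t)$ such that $\beta_n=\frac14+\sum_{j=1}^{N}a_jn^{-j}+O(n^{-N-1})$ as $n\to\infty$ for every $N\ge1$), where the first few expansion coefficients are $$a_1=0,\qquad a_2=\tfrac1{16}(1-4\alpha^2),\qquad a_3=\tfrac1{16}(1-4\alpha^2)(t-2\alpha),$$ $$a_4=\tfrac1{64}(1-4\alpha^2)(3t^2-12\alpha t+12\alpha^2+1),$$ $$a_5=\tfrac1{64}(1-4\alpha^2)\left[2t^3-12\alpha t^2+(11+20\alpha^2)t-4\alpha(1+4\alpha^2)\right],$$ $$a_6=\tfrac1{256}(1-4\alpha^2)\left[5t^4-40\alpha t^3+20(5+4\alpha^2)t^2-20\alpha(11+4\alpha^2)t+80\alpha^4+40\alpha^2+1\right].$$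
   Context: For $\alpha>-1$ and $t\in\mathbb{R}$ let $w(x,t)=(1-x^2)^{\alpha}e^{-tx^2}$, $x\in[-1,1]$. Let $P_n(x,t)$, $n=0,1,2,\ldots$, be the monic polynomials of degree $n$ orthogonal with respect to $w$: $\int_{-1}^1P_m(x,t)P_n(x,t)w(x,t)\,dx=h_n(t)\delta_{mn}$. Since $w$ is even they satisfy $xP_n(x,t)=P_{n+1}(x,t)+\beta_n(t)P_{n-1}(x,t)$ with $P_0=1$, $P_{-1}=0$; for $n\ge1$, $\beta_n(t)=h_n(t)/h_{n-1}(t)$. The infinite series is an asymptotic (not necessarily convergent) expansion. *)

theory Defs
  imports "HOL-Analysis.Analysis" "HOL-Computational_Algebra.Polynomial"
    "HOL-Library.Landau_Symbols"
begin

text \<open>Only used for \<open>x\<close> in \<open>[-1,1]\<close>. For \<open>\<alpha> \<le> 0\<close> the values at the endpoints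
  (where \<open>0 powr \<alpha> = 0\<close>) are a convention without influence on the integrals below.\<close>

definition weight :: "real \<Rightarrow> real \<Rightarrow> real \<Rightarrow> real" where
  "weight \<alpha> t x = (1 - x\<^sup>2) powr \<alpha> * exp (- t * x\<^sup>2)"

text \<open>\<open>h n\<close> is the squared norm of \<open>P n\<close>; the case \<open>m = n\<close> below defines it.\<close>

definition monic_orthogonal_polys ::
    "real \<Rightarrow> real \<Rightarrow> (nat \<Rightarrow> real poly) \<Rightarrow> (nat \<Rightarrow> real) \<Rightarrow> bool" where
  "monic_orthogonal_polys \<alpha> t P h \<longleftrightarrow>
     (\<forall>n. degree (P n) = n \<and> lead_coeff (P n) = 1) \<and>
     (\<forall>m n. (LINT x:{-1..1}|lborel. poly (P m) x * poly (P n) x * weight \<alpha> t x)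
              = (if m = n then h n else 0))"

text \<open>The three-term recurrence \<open>x P\<^sub>n = P\<^sub>n\<^sub>+\<^sub>1 + \<beta>\<^sub>n P\<^sub>n\<^sub>-\<^sub>1\<close> with the convention that \<open>P\<^sub>-\<^sub>1 = 0\<close>,
  which leaves \<open>\<beta> 0\<close> unconstrained.\<close>

definition recurrence_coeffs :: "(nat \<Rightarrow> real poly) \<Rightarrow> (nat \<Rightarrow> real) \<Rightarrow> bool" where
  "recurrence_coeffs P \<beta> \<longleftrightarrow>
     (\<forall>n. [:0, 1:] * P n = P (Suc n) + smult (\<beta> n) (if n = 0 then 0 else P (n - 1)))"

definition has_inverse_power_expansion ::
    "(nat \<Rightarrow> real) \<Rightarrow> real \<Rightarrow> (nat \<Rightarrow> real) \<Rightarrow> bool" where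
  "has_inverse_power_expansion f c a \<longleftrightarrow>
     (\<forall>N\<ge>1. (\<lambda>n. f n - (c + (\<Sum>j=1..N. a j / real n ^ j))) \<in> O(\<lambda>n. 1 / real n ^ (N + 1)))"

end

theory Submission
  imports Defs "HOL-Real_Asymp.Real_Asymp"
begin

text \<open>
  The weight satisfies a Pearson equation \<open>(\<sigma> w)' = \<tau> w\<close> with \<open>\<sigma> = 1 - x\<^sup>2\<close> and a cubic \<open>\<tau>\<close>.
  Integration by parts therefore expresses \<open>\<sigma> P\<^sub>n'\<close> through \<open>P\<^sub>n\<^sub>+\<^sub>1\<close>, \<open>P\<^sub>n\<^sub>-\<^sub>1\<close> and \<open>P\<^sub>n\<^sub>-\<^sub>3\<close>
  (\<open>structure_relation\<close>), and the recurrence reduces this to \<open>\<sigma> P\<^sub>n' = F\<^sub>n P\<^sub>n + G\<^sub>n P\<^sub>n\<^sub>-\<^sub>1\<close>. At the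
  singular point \<open>x = 1\<close> the left-hand side vanishes. Together with the same relation for \<open>n - 1\<close> this
  gives two homogeneous linear equations for \<open>P\<^sub>n(1)\<close> and \<open>P\<^sub>n\<^sub>-\<^sub>1(1)\<close>, which are not both zero. Hence a
  determinant vanishes, and this is an equation for the recurrence coefficients alone
  (\<open>eventually_string_equation\<close>):

  \<open>\<beta>\<^sub>n R\<^sub>n R\<^sub>n\<^sub>-\<^sub>1 = (n - 2 t \<beta>\<^sub>n) (n + 2 \<alpha> - 2 t \<beta>\<^sub>n)\<close>, where \<open>R\<^sub>n = 2 n + 1 + 2 \<alpha> - 2 t (\<beta>\<^sub>n\<^sub>+\<^sub>1 + \<beta>\<^sub>n)\<close>.

  For \<open>t = 0\<close> it is the explicit formula for the Gegenbauer polynomials. For general \<open>t\<close> it determines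
  the asymptotics as well. The coefficients are bounded, because multiplication by \<open>x\<close> is a
  contraction on \<open>L\<^sup>2 ([-1, 1], w)\<close>. After division by \<open>n\<^sup>2\<close> the equation expresses \<open>\<beta>\<^sub>n\<close> as a quotient
  into which \<open>\<beta>\<close> enters only through \<open>\<beta>\<^sub>n / n\<close> and \<open>\<beta>\<^sub>n\<^sub>\<plusminus>\<^sub>1 / n\<close>. An expansion of \<open>\<beta>\<close> with error \<open>O(n\<^sup>-\<^sup>N)\<close>
  therefore implies one with error \<open>O(n\<^sup>-\<^sup>N\<^sup>-\<^sup>1)\<close>, and iteration starting from boundedness yields
  expansions of every order (\<open>approx_exists\<close>). The values of the first coefficients follow by comparing
  coefficients in the equation (\<open>coefficients\<close>).
\<close>

section \<open>Integrals against the weight\<close>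

definition weighted_integral :: "real \<Rightarrow> real \<Rightarrow> real poly \<Rightarrow> real" where
  "weighted_integral \<alpha> t Q = (LINT x:{-1..1}|lborel. poly Q x * weight \<alpha> t x)"

lemma borel_measurable_poly [measurable]: "poly (Q :: real poly) \<in> borel_measurable borel"
  by (intro borel_measurable_continuous_onI continuous_intros)

lemma borel_measurable_weight [measurable]: "weight \<alpha> t \<in> borel_measurable borel"
  unfolding weight_def by measurable

text \<open>The substitution \<open>x = 2 u - 1\<close> turns \<open>1 - x\<^sup>2\<close> into \<open>4 u (1 - u)\<close>, so this is the convergence of
  the Beta integral \<open>B (\<alpha> + 1) (\<alpha> + 1)\<close>.\<close>

lemma set_integrable_jacobi_weight:
  fixes \<alpha> :: real
  assumes "\<alpha> > -1"
  shows "set_integrable lborel {-1..1} (\<lambda>x. (1 - x\<^sup>2) powr \<alpha>)"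
proof -
  let ?g = "\<lambda>u::real. u powr \<alpha> * (1 - u) powr \<alpha>"
  have "?g integrable_on {0..1}"
    using has_integral_Beta_real[of "\<alpha> + 1" "\<alpha> + 1"] assms by (auto simp: integrable_on_def)
  then have "?g absolutely_integrable_on {0..1}"
    by (rule nonnegative_absolutely_integrable_1) auto
  then have "integrable lborel (\<lambda>u. indicator {0..1} u *\<^sub>R ?g u)"
    unfolding set_integrable_def by (subst integrable_completion[symmetric]) auto
  then have "integrable lborel (\<lambda>x. indicator {0..1} (1/2 + 1/2 * x) *\<^sub>R ?g (1/2 + 1/2 * x))"
    by (rule lborel_integrable_real_affine) simp
  then have "integrable lborel (\<lambda>x. 4 powr \<alpha> *
      (indicator {0..1} (1/2 + 1/2 * x) *\<^sub>R ?g (1/2 + 1/2 * x)))"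
    by (rule integrable_mult_right)
  also have "(\<lambda>x. 4 powr \<alpha> * (indicator {0..1} (1/2 + 1/2 * x) *\<^sub>R ?g (1/2 + 1/2 * x)))
      = (\<lambda>x. indicator {-1..1} x *\<^sub>R (1 - x\<^sup>2) powr \<alpha>)"
  proof
    fix x :: real
    show "4 powr \<alpha> * (indicator {0..1} (1/2 + 1/2 * x) *\<^sub>R ?g (1/2 + 1/2 * x))
      = indicator {-1..1} x *\<^sub>R (1 - x\<^sup>2) powr \<alpha>"
    proof (cases "x \<in> {-1..1}")
      case True
      have "1 - x\<^sup>2 = 4 * ((1/2 + 1/2 * x) * (1 - (1/2 + 1/2 * x)))"
        by (simp add: power2_eq_square algebra_simps)
      moreover have "(4 * ((1/2 + 1/2 * x) * (1 - (1/2 + 1/2 * x)))) powr \<alpha>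
          = 4 powr \<alpha> * ?g (1/2 + 1/2 * x)"
        using True by (simp only: powr_mult)
      ultimately show ?thesis
        using True by (simp add: indicator_def)
    qed (auto simp: indicator_def)
  qed
  finally show ?thesis
    unfolding set_integrable_def .
qed

lemma set_integrable_poly_weight:
  assumes "\<alpha> > -1"
  shows "set_integrable lborel {-1..1} (\<lambda>x. poly Q x * weight \<alpha> t x)"
proof -
  have cont: "continuous_on {-1..1} (\<lambda>x. poly Q x * exp (- t * x\<^sup>2))"
    by (intro continuous_intros)
  then have "bounded ((\<lambda>x. poly Q x * exp (- t * x\<^sup>2)) ` {-1..1})"
    by (intro compact_imp_bounded compact_continuous_image) auto
  then obtain C where C: "\<And>x. x \<in> {-1..1} \<Longrightarrow> \<bar>poly Q x * exp (- t * x\<^sup>2)\<bar> \<le> C"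
    unfolding bounded_iff by fastforce
  have "set_integrable lborel {-1..1} (\<lambda>x. C * (1 - x\<^sup>2) powr \<alpha>)"
    by (intro set_integrable_mult_right set_integrable_jacobi_weight assms)
  then show ?thesis
  proof (rule set_integrable_bound)
    show "set_borel_measurable lborel {-1..1} (\<lambda>x. poly Q x * weight \<alpha> t x)"
      unfolding set_borel_measurable_def by measurable
    show "AE x in lborel. x \<in> {-1..1} \<longrightarrow>
        norm (poly Q x * weight \<alpha> t x) \<le> norm (C * (1 - x\<^sup>2) powr \<alpha>)"
    proof (intro AE_I2 impI)
      fix x :: real assume x: "x \<in> {-1..1}"
      have "\<bar>poly Q x * exp (- t * x\<^sup>2)\<bar> * (1 - x\<^sup>2) powr \<alpha> \<le> \<bar>C\<bar> * (1 - x\<^sup>2) powr \<alpha>"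
        using C[OF x] by (intro mult_right_mono) auto
      then show "norm (poly Q x * weight \<alpha> t x) \<le> norm (C * (1 - x\<^sup>2) powr \<alpha>)"
        by (simp add: weight_def abs_mult mult_ac)
    qed
  qed
qed

lemma weighted_integral_simps:
  assumes "\<alpha> > -1"
  shows "weighted_integral \<alpha> t 0 = 0"
    and "weighted_integral \<alpha> t (Q + R) = weighted_integral \<alpha> t Q + weighted_integral \<alpha> t R"
    and "weighted_integral \<alpha> t (Q - R) = weighted_integral \<alpha> t Q - weighted_integral \<alpha> t R"
    and "weighted_integral \<alpha> t (smult c Q) = c * weighted_integral \<alpha> t Q"
  using set_integrable_poly_weight[OF assms, of Q t] set_integrable_poly_weight[OF assms, of R t]
  by (simp_all add: weighted_integral_def algebra_simps)

lemma weight_pos: "x \<in> {-1<..<1} \<Longrightarrow> weight \<alpha> t x > 0"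
  using abs_square_less_1[of x] by (auto simp: weight_def abs_less_iff)

lemma weighted_integral_nonneg:
  assumes "\<And>x. x \<in> {-1..1} \<Longrightarrow> poly Q x \<ge> 0"
  shows "weighted_integral \<alpha> t Q \<ge> 0"
  unfolding weighted_integral_def set_lebesgue_integral_def
  using assms by (intro integral_nonneg_AE AE_I2) (auto simp: indicator_def weight_def)

lemma weighted_integral_pos:
  assumes "\<alpha> > -1" "Q \<noteq> 0" "\<And>x. x \<in> {-1..1} \<Longrightarrow> poly Q x \<ge> 0"
  shows "weighted_integral \<alpha> t Q > 0"
proof (rule ccontr)
  let ?f = "\<lambda>x. indicator {-1..1} x *\<^sub>R (poly Q x * weight \<alpha> t x)"
  assume "\<not> weighted_integral \<alpha> t Q > 0"
  with weighted_integral_nonneg[OF assms(3), where \<alpha> = \<alpha> and t = t]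
  have "integral\<^sup>L lborel ?f = 0"
    unfolding weighted_integral_def set_lebesgue_integral_def by simp
  moreover have "AE x in lborel. ?f x \<ge> 0"
    using assms(3) by (intro AE_I2) (auto simp: indicator_def weight_def)
  moreover have "integrable lborel ?f"
    using set_integrable_poly_weight[OF assms(1)] unfolding set_integrable_def .
  ultimately have "AE x in lborel. ?f x = 0"
    using integral_nonneg_eq_0_iff_AE by blast
  moreover have "AE x in lborel. x \<notin> {x. poly Q x = 0}"
    by (intro AE_not_in finite_imp_null_set_lborel poly_roots_finite assms(2))
  ultimately have "AE x in lborel. x \<notin> {-1<..<1::real}"
    by eventually_elim (use weight_pos[of _ \<alpha> t] in \<open>force simp: indicator_def\<close>)
  then have "emeasure lborel {-1<..<1::real} = 0"
    by (subst (asm) AE_iff_measurable[OF _ refl])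
      (auto simp: greaterThanLessThan_def greaterThan_def lessThan_def Int_def)
  then show False by simp
qed

text \<open>The coefficients of the Pearson equation \<open>(\<sigma> w)' = \<tau> w\<close> of the weight, with \<open>\<sigma> = 1 - x\<^sup>2\<close>.
  What makes the whole argument work is that \<open>\<sigma>\<close> vanishes at the endpoints and \<open>\<tau>\<close> is a polynomial.\<close>

definition pearson_sigma :: "real poly" where "pearson_sigma = [:1, 0, -1:]"

definition pearson_tau :: "real \<Rightarrow> real \<Rightarrow> real poly" where
  "pearson_tau \<alpha> t = [:0, - (2 + 2 * \<alpha> + 2 * t), 0, 2 * t:]"

text \<open>The integrand is the derivative of \<open>\<sigma> w Q\<close>, a multiple of \<open>(1 - x\<^sup>2) powr (\<alpha> + 1)\<close>; since
  \<open>\<alpha> + 1 > 0\<close>, this function is continuous on the closed interval and zero at \<open>\<plusminus> 1\<close>, even where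
  the weight itself is unbounded.\<close>

lemma weighted_integral_by_parts:
  assumes "\<alpha> > -1"
  shows "weighted_integral \<alpha> t (pearson_sigma * pderiv Q + pearson_tau \<alpha> t * Q) = 0"
proof -
  let ?R = "pearson_sigma * pderiv Q + pearson_tau \<alpha> t * Q"
  let ?F = "\<lambda>x. poly Q x * ((1 - x\<^sup>2) powr (\<alpha> + 1) * exp (- t * x\<^sup>2))"
  have cont: "continuous_on {-1..1} ?F"
    using assms by (auto intro!: continuous_intros continuous_on_powr' simp: abs_square_le_1)
  have deriv: "(?F has_vector_derivative poly ?R x * weight \<alpha> t x) (at x)"
    if x: "x \<in> {-1<..<1}" for x
  proof -
    have pos: "1 - x\<^sup>2 > 0"
      using x by (simp add: abs_square_less_1 abs_less_iff)
    have step: "(1 - x * x) powr (1 + \<alpha>) = (1 - x * x) * (1 - x * x) powr \<alpha>"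
      using pos by (simp add: powr_add power2_eq_square)
    have "(?F has_field_derivative poly ?R x * weight \<alpha> t x) (at x)"
      by (rule derivative_eq_intros refl pos | simp)+
        (use pos in \<open>simp add: step weight_def pearson_sigma_def pearson_tau_def
            algebra_simps power2_eq_square power3_eq_cube\<close>)
    then show ?thesis
      by (simp add: has_real_derivative_iff_has_vector_derivative)
  qed
  have "((\<lambda>x. poly ?R x * weight \<alpha> t x) has_integral (?F 1 - ?F (-1))) {-1..1}"
    by (rule fundamental_theorem_of_calculus_interior[OF _ cont deriv]) auto
  then have "integral {-1..1} (\<lambda>x. poly ?R x * weight \<alpha> t x) = 0"
    by (simp add: integral_unique)
  then show ?thesis
    unfolding weighted_integral_def
    using set_borel_integral_eq_integral(2)[OF set_integrable_poly_weight[OF assms]] by metis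
qed

section \<open>The string equation for the recurrence coefficients\<close>

lemma coeff_pearson_sigma_mult:
  "coeff (pearson_sigma * Q) k = coeff Q k - (if k \<ge> 2 then coeff Q (k - 2) else 0)"
  by (cases k; cases "k - 1") (auto simp: pearson_sigma_def coeff_pCons split: nat.splits)

locale weighted_orthogonal_polys =
  fixes \<alpha> t :: real and P :: "nat \<Rightarrow> real poly" and h \<beta> :: "nat \<Rightarrow> real"
  assumes alpha: "\<alpha> > -1"
    and orthogonal: "monic_orthogonal_polys \<alpha> t P h"
    and recurrence: "recurrence_coeffs P \<beta>"
begin

abbreviation \<L> :: "real poly \<Rightarrow> real" where "\<L> \<equiv> weighted_integral \<alpha> t"

lemmas \<L>_simps = weighted_integral_simps[OF alpha]

lemma degree_P [simp]: "degree (P n) = n"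
  and coeff_P_top [simp]: "coeff (P n) n = 1"
  using orthogonal unfolding monic_orthogonal_polys_def by metis+

lemma \<L>_P_P: "\<L> (P m * P n) = (if m = n then h n else 0)"
  using orthogonal unfolding monic_orthogonal_polys_def weighted_integral_def by simp

lemma h_pos: "h n > 0"
proof -
  have "P n \<noteq> 0" using coeff_P_top[of n] by (metis coeff_0 zero_neq_one)
  then have "\<L> (P n * P n) > 0"
    by (intro weighted_integral_pos alpha) auto
  then show ?thesis by (simp add: \<L>_P_P)
qed

lemma \<L>_orthogonal:
  assumes "\<And>i. i \<ge> k \<Longrightarrow> coeff Q i = 0" "k \<le> n"
  shows "\<L> (Q * P n) = 0"
  using assms
proof (induction k arbitrary: Q)
  case 0
  then have "Q = 0" by (simp add: poly_eq_iff)
  then show ?case by (simp add: \<L>_simps)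
next
  case (Suc k)
  let ?R = "Q - smult (coeff Q k) (P k)"
  have "coeff ?R i = 0" if "i \<ge> k" for i
    using that Suc.prems(1)[of i] by (cases "i = k") (auto simp: coeff_eq_0)
  from this have "\<L> (?R * P n) = 0"
    by (rule Suc.IH) (use Suc.prems(2) in simp_all)
  then have "\<L> (Q * P n) = coeff Q k * \<L> (P k * P n)"
    by (simp add: left_diff_distrib \<L>_simps)
  then show ?case
    using Suc.prems(2) by (simp add: \<L>_P_P)
qed

lemma \<L>_leading:
  assumes "\<And>i. i > n \<Longrightarrow> coeff Q i = 0"
  shows "\<L> (Q * P n) = coeff Q n * h n"
proof -
  let ?R = "Q - smult (coeff Q n) (P n)"
  have "coeff ?R i = 0" if "i \<ge> n" for i
    using that assms[of i] by (cases "i = n") (auto simp: coeff_eq_0)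
  from \<L>_orthogonal[OF this order_refl] have "\<L> (?R * P n) = 0" .
  then show ?thesis
    by (simp add: left_diff_distrib \<L>_simps \<L>_P_P)
qed

lemma poly_eq_0_if_orthogonal:
  assumes "\<And>k. \<L> (Q * P k) = 0"
  shows "Q = 0"
proof -
  have "coeff Q (degree Q) * h (degree Q) = 0"
    using assms by (subst \<L>_leading[symmetric]) (auto simp: coeff_eq_0)
  then show ?thesis
    using h_pos[of "degree Q"] by simp
qed

lemma X_mult_P: "[:0, 1:] * P (Suc n) = P (Suc (Suc n)) + smult (\<beta> (Suc n)) (P n)"
  using recurrence unfolding recurrence_coeffs_def 
  by (elim allE[of _ "Suc n"]) (simp only: diff_Suc_1 nat.distinct if_False)

lemma \<beta>_h: "\<beta> (Suc n) * h n = h (Suc n)"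
proof -
  have "\<beta> (Suc n) * h n = \<L> ([:0, 1:] * P (Suc n) * P n)"
    by (simp only: X_mult_P) (simp add: distrib_right \<L>_simps \<L>_P_P)
  also have "\<dots> = \<L> (([:0, 1:] * P n) * P (Suc n))"
    by (simp only: mult_ac)
  also have "\<dots> = h (Suc n)"
    by (subst \<L>_leading) (auto simp: coeff_pCons coeff_eq_0 split: nat.splits)
  finally show ?thesis .
qed

lemma \<beta>_pos: "\<beta> (Suc n) > 0"
  using zero_less_mult_pos2[of "\<beta> (Suc n)" "h n"] h_pos[of n] h_pos[of "Suc n"] by (simp add: \<beta>_h)

text \<open>Multiplication by \<open>x\<close> does not increase the norm in \<open>L\<^sup>2 ([-1, 1], w)\<close>, and \<open>P (n + 1)\<close> is one of the
  two orthogonal components of \<open>x P n\<close>. Hence the ratio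
  \<open>\<beta> (n + 1) = h (n + 1) / h n\<close> is at most 1.\<close>

lemma \<beta>_le_1: "\<beta> (Suc (Suc n)) \<le> 1"
proof -
  let ?X = "[:0, 1:] :: real poly"
  have "0 \<le> \<L> ([:1, 0, -1:] * (P (Suc n) * P (Suc n)))"
  proof (rule weighted_integral_nonneg)
    fix x :: real assume "x \<in> {-1..1}"
    then have "(1 - x\<^sup>2) * (poly (P (Suc n)) x)\<^sup>2 \<ge> 0"
      by (intro mult_nonneg_nonneg) (auto simp: abs_square_le_1 abs_le_iff)
    then show "poly ([:1, 0, -1:] * (P (Suc n) * P (Suc n))) x \<ge> 0"
      by (simp add: power2_eq_square algebra_simps)
  qed
  also have "[:1, 0, -1:] * (P (Suc n) * P (Suc n))
      = P (Suc n) * P (Suc n) - (?X * P (Suc n)) * (?X * P (Suc n))"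
    by (simp add: algebra_simps)
  also have "\<L> \<dots> = h (Suc n) - (h (Suc (Suc n)) + (\<beta> (Suc n))\<^sup>2 * h n)"
    unfolding X_mult_P by (simp add: ring_distribs \<L>_simps \<L>_P_P power2_eq_square)
  finally have "h (Suc (Suc n)) \<le> h (Suc n)"
    using mult_nonneg_nonneg[OF zero_le_power2[of "\<beta> (Suc n)"] less_imp_le[OF h_pos[of n]]]
    by linarith
  then have "\<beta> (Suc (Suc n)) * h (Suc n) \<le> 1 * h (Suc n)"
    by (simp add: \<beta>_h)
  then show ?thesis
    using h_pos[of "Suc n"] mult_le_cancel_right_pos by blast
qed

lemma X_cubed_mult_P:
  defines "X \<equiv> [:0, 1:] :: real poly"
  shows "X * (X * (X * P (n + 3))) = P (n + 6)
    + smult (\<beta> (n + 5) + \<beta> (n + 4) + \<beta> (n + 3)) (P (n + 4))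
    + smult (\<beta> (n + 3) * (\<beta> (n + 4) + \<beta> (n + 3) + \<beta> (n + 2))) (P (n + 2))
    + smult (\<beta> (n + 3) * \<beta> (n + 2) * \<beta> (n + 1)) (P n)"
proof -
  have step: "X * P (Suc k) = P (Suc (Suc k)) + smult (\<beta> (Suc k)) (P k)" for k
    unfolding X_def by (rule X_mult_P)
  show ?thesis
    by (simp add: numeral_eq_Suc step distrib_left smult_add_right)
      (simp add: poly_eq_iff algebra_simps)
qed

text \<open>The indices are shifted by 3 here and below, so that no polynomial of negative index occurs.\<close>

lemma tau_mult_P:
  "pearson_tau \<alpha> t * P (n + 3) =
    smult (- (2 + 2 * \<alpha> + 2 * t)) (P (n + 4) + smult (\<beta> (n + 3)) (P (n + 2)))
    + smult (2 * t) (P (n + 6)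
      + smult (\<beta> (n + 5) + \<beta> (n + 4) + \<beta> (n + 3)) (P (n + 4))
      + smult (\<beta> (n + 3) * (\<beta> (n + 4) + \<beta> (n + 3) + \<beta> (n + 2))) (P (n + 2))
      + smult (\<beta> (n + 3) * \<beta> (n + 2) * \<beta> (n + 1)) (P n))"
proof -
  define X :: "real poly" where "X = [:0, 1:]"
  have "pearson_tau \<alpha> t = smult (- (2 + 2 * \<alpha> + 2 * t)) X + smult (2 * t) (X * (X * X))"
    by (simp add: pearson_tau_def X_def)
  then have "pearson_tau \<alpha> t * P (n + 3) = smult (- (2 + 2 * \<alpha> + 2 * t)) (X * P (n + 3))
      + smult (2 * t) (X * (X * (X * P (n + 3))))"
    by (simp add: algebra_simps)
  then show ?thesis
    using X_mult_P[of "n + 2"] X_cubed_mult_P[of n] by (simp only: X_def) (simp add: numeral_eq_Suc)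
qed

lemma coeff_sigma_pderiv_P:
  "coeff (pearson_sigma * pderiv (P n)) (Suc n) = - real n"
  "k > Suc n \<Longrightarrow> coeff (pearson_sigma * pderiv (P n)) k = 0"
  by (auto simp: coeff_pearson_sigma_mult coeff_pderiv coeff_eq_0 Suc_diff_Suc numeral_2_eq_2)

text \<open>Integration by parts moves \<open>\<sigma> d/dx\<close> from one factor to the other at the price of \<open>\<tau>\<close>.\<close>

lemma \<L>_sigma_pderiv_swap:
  "\<L> (pearson_sigma * pderiv Q * R) = - \<L> (pearson_tau \<alpha> t * Q * R) - \<L> (pearson_sigma * pderiv R * Q)"
  using weighted_integral_by_parts[OF alpha, of t "Q * R"]
  by (simp add: pderiv_mult algebra_simps \<L>_simps)

text \<open>Expand \<open>\<sigma> P\<^sub>n'\<close> in the orthogonal basis. Its degree leaves no component beyond \<open>P\<^sub>n\<^sub>+\<^sub>1\<close>. After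
  integration by parts, \<open>\<tau>\<close> of degree 3 leaves no component below \<open>P\<^sub>n\<^sub>-\<^sub>3\<close>, and the components
  along \<open>P\<^sub>n\<close> and \<open>P\<^sub>n\<^sub>-\<^sub>2\<close> vanish because \<open>\<tau>\<close> is odd.\<close>

lemma structure_relation:
  defines "A \<equiv> \<lambda>n. \<beta> (n + 3) * (n + 4 + 2 * \<alpha> + 2 * t
      - 2 * t * (\<beta> (n + 4) + \<beta> (n + 3) + \<beta> (n + 2)))"
  shows "pearson_sigma * pderiv (P (n + 3)) =
      smult (- real (n + 3)) (P (n + 4)) + smult (A n) (P (n + 2))
      - smult (2 * t * (\<beta> (n + 3) * \<beta> (n + 2) * \<beta> (n + 1))) (P n)"
    (is "?S = ?T")
proof -
  have "\<L> ((?S - ?T) * P k) = 0" for k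
  proof -
    have T: "\<L> (?T * P k) = - real (n + 3) * (if k = n + 4 then h k else 0)
        + A n * (if k = n + 2 then h k else 0)
        - 2 * t * (\<beta> (n + 3) * \<beta> (n + 2) * \<beta> (n + 1)) * (if k = n then h k else 0)"
      by (simp add: ring_distribs \<L>_simps \<L>_P_P)
    have tau: "\<L> (pearson_tau \<alpha> t * P (n + 3) * P k) =
        - (2 + 2 * \<alpha> + 2 * t) * (\<beta> (n + 3) * (if k = n + 2 then h k else 0))
        + 2 * t * (\<beta> (n + 3) * (\<beta> (n + 4) + \<beta> (n + 3) + \<beta> (n + 2)) * (if k = n + 2 then h k else 0)
          + \<beta> (n + 3) * \<beta> (n + 2) * \<beta> (n + 1) * (if k = n then h k else 0))" 
      if "k \<le> n + 3"
      unfolding tau_mult_P using that by (simp add: ring_distribs \<L>_simps \<L>_P_P)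
    have sigma: "\<L> (pearson_sigma * pderiv (P k) * P (n + 3)) = 
        (if k = n + 2 then - real k * h (n + 3) else 0)" if "k < n + 3"
      using that coeff_sigma_pderiv_P(1)[of "n + 2"]
      by (subst \<L>_leading) (auto simp: coeff_sigma_pderiv_P(2) numeral_eq_Suc)
    consider "k \<ge> n + 5" | "k = n + 4" | "k = n + 3" | "k < n + 3" by linarith
    then have "\<L> (?S * P k) = \<L> (?T * P k)"
    proof cases
      case 1
      then show ?thesis 
        unfolding T by (subst \<L>_leading) (auto simp: coeff_sigma_pderiv_P)
    next
      case 2
      then show ?thesis 
        unfolding T using coeff_sigma_pderiv_P[of "n + 3"]
        by (subst \<L>_leading) (auto simp: numeral_eq_Suc)
    next
      case 3
      \<comment> \<open>Here the two factors coincide, so the swap determines the integral from the \<open>\<tau>\<close> term alone.\<close>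
      then show ?thesis 
        unfolding T using \<L>_sigma_pderiv_swap[of "P (n + 3)" "P k"] tau by simp
    next
      case 4
      have "\<L> (?S * P k) = - \<L> (pearson_tau \<alpha> t * P (n + 3) * P k)
          - \<L> (pearson_sigma * pderiv (P k) * P (n + 3))"
        by (rule \<L>_sigma_pderiv_swap)
      then show ?thesis
        unfolding T sigma[OF 4] using 4 tau \<beta>_h[of "n + 2"]
        by (auto simp: A_def algebra_simps numeral_eq_Suc)
    qed
    then show ?thesis
      by (simp add: left_diff_distrib \<L>_simps)
  qed
  then have "?S - ?T = 0" by (rule poly_eq_0_if_orthogonal)
  then show ?thesis by simp
qed

text \<open>\<open>\<beta> n * R n\<close> is the value at \<open>1\<close> of the coefficient of \<open>P\<^sub>n\<^sub>-\<^sub>1\<close> when the structure relation is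
  reduced, by the recurrence, to \<open>\<sigma> P\<^sub>n' = F\<^sub>n P\<^sub>n + G\<^sub>n P\<^sub>n\<^sub>-\<^sub>1\<close>.\<close>

definition R :: "nat \<Rightarrow> real" where
  "R n = 2 * n + 1 + 2 * \<alpha> - 2 * t * (\<beta> (Suc n) + \<beta> n)"

lemma recurrence_at_1: "poly (P (Suc (Suc n))) 1 = poly (P (Suc n)) 1 - \<beta> (Suc n) * poly (P n) 1"
  using arg_cong[OF X_mult_P[of n], of "\<lambda>Q. poly Q 1"] by simp

lemma P_P_Suc_at_1: "poly (P n) 1 \<noteq> 0 \<or> poly (P (Suc n)) 1 \<noteq> 0"
proof (induction n)
  case 0
  have "P 0 = 1" using coeff_P_top[of 0] degree_P[of 0] by (metis degree_0_id one_pCons)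
  then show ?case by simp
next
  case (Suc n)
  then show ?case using \<beta>_pos[of n] by (auto simp: recurrence_at_1)
qed

text \<open>At \<open>x = 1\<close> the left-hand side \<open>\<sigma> P\<^sub>n'\<close> of the structure relation disappears. What remains is
  linear in values of the polynomials at \<open>1\<close>, and the recurrence reduces these to two neighbours.\<close>

lemma lowering_at_1:
  "(real (n + 3) - 2 * t * \<beta> (n + 3)) * poly (P (n + 3)) 1
     = \<beta> (n + 3) * R (n + 3) * poly (P (n + 2)) 1"
proof -
  have eq: "0 = - real (n + 3) * poly (P (n + 4)) 1 + \<beta> (n + 3) * (n + 4 + 2 * \<alpha> + 2 * t
      - 2 * t * (\<beta> (n + 4) + \<beta> (n + 3) + \<beta> (n + 2))) * poly (P (n + 2)) 1
      - 2 * t * (\<beta> (n + 3) * \<beta> (n + 2) * (\<beta> (n + 1) * poly (P n) 1))"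
    using arg_cong[OF structure_relation[of n], of "\<lambda>Q. poly Q 1"]
    by (simp add: pearson_sigma_def mult_ac)
  have u4: "poly (P (n + 4)) 1 = poly (P (n + 3)) 1 - \<beta> (n + 3) * poly (P (n + 2)) 1"
    and u1: "\<beta> (n + 1) * poly (P n) 1 = poly (P (n + 1)) 1 - poly (P (n + 2)) 1"
    and u2: "\<beta> (n + 2) * poly (P (n + 1)) 1 = poly (P (n + 2)) 1 - poly (P (n + 3)) 1"
    using recurrence_at_1[of "n + 2"] recurrence_at_1[of n] recurrence_at_1[of "n + 1"]
    by (simp_all add: numeral_eq_Suc)
  have u12: "\<beta> (n + 2) * (\<beta> (n + 1) * poly (P n) 1)
      = poly (P (n + 2)) 1 - poly (P (n + 3)) 1 - \<beta> (n + 2) * poly (P (n + 2)) 1"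
    unfolding u1 right_diff_distrib u2 ..
  have "R (n + 3) = 2 * n + 7 + 2 * \<alpha> - 2 * t * (\<beta> (n + 4) + \<beta> (n + 3))"
    by (simp add: R_def numeral_eq_Suc)
  with eq u4 u12 show ?thesis by (simp add: mult.assoc) algebra
qed

text \<open>This is the previous identity after eliminating \<open>P (n + 2)\<close> in favour of \<open>P (n + 4)\<close>.\<close>

lemma raising_at_1:
  "(real (n + 4) + 2 * \<alpha> - 2 * t * \<beta> (n + 4)) * poly (P (n + 3)) 1
     = R (n + 3) * poly (P (n + 4)) 1"
proof -
  have "\<beta> (n + 3) * poly (P (n + 2)) 1 = poly (P (n + 3)) 1 - poly (P (n + 4)) 1"
    using recurrence_at_1[of "n + 2"] by (simp add: numeral_eq_Suc)
  moreover have "R (n + 3) = 2 * n + 7 + 2 * \<alpha> - 2 * t * (\<beta> (n + 4) + \<beta> (n + 3))"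
    by (simp add: R_def numeral_eq_Suc)
  ultimately show ?thesis
    using lowering_at_1[of n] by (simp add: mult.assoc) algebra
qed

text \<open>The two preceding lemmas are homogeneous linear equations for the nonzero vector
  \<open>(P\<^sub>n(1), P\<^sub>n\<^sub>-\<^sub>1(1))\<close>, so their determinant vanishes. For large \<open>n\<close> the coefficients on the left
  are nonzero, hence neither entry of the vector is zero and both can be cancelled from the product
  of the two equations.\<close>

lemma eventually_string_equation:
  "eventually (\<lambda>n. \<beta> n * R n * R (n - 1)
     = (real n - 2 * t * \<beta> n) * (real n + 2 * \<alpha> - 2 * t * \<beta> n)) sequentially"
proof -
  have "eventually (\<lambda>n. real n > 2 * \<bar>t\<bar> + 2 * \<bar>\<alpha>\<bar> \<and> n \<ge> 4) sequentially"
    by (intro eventually_conj eventually_ge_at_top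
        filterlim_real_sequentially[THEN filterlim_at_top_dense[THEN iffD1], rule_format])
  then show ?thesis
  proof eventually_elim
    case (elim n)
    then obtain m where n: "n = m + 4" using le_Suc_ex[of 4 n] by (auto simp: add_ac)
    let ?u = "poly (P n) 1" and ?v = "poly (P (n - 1)) 1"
    have low: "(real n - 2 * t * \<beta> n) * ?u = \<beta> n * R n * ?v"
      using lowering_at_1[of "m + 1"] by (simp add: n add_ac numeral_eq_Suc)
    have up: "(real n + 2 * \<alpha> - 2 * t * \<beta> n) * ?v = R (n - 1) * ?u"
      using raising_at_1[of m] by (simp add: n add_ac numeral_eq_Suc)
    have \<beta>: "0 < \<beta> n" "\<beta> n \<le> 1"
      using \<beta>_pos[of "m + 3"] \<beta>_le_1[of "m + 2"] by (simp_all add: n numeral_eq_Suc)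
    then have "\<bar>t * \<beta> n\<bar> \<le> \<bar>t\<bar>"
      by (simp add: abs_mult mult_left_le)
    with elim have pos: "real n - 2 * t * \<beta> n > 0" "real n + 2 * \<alpha> - 2 * t * \<beta> n > 0"
      by linarith+
    have "?u \<noteq> 0 \<or> ?v \<noteq> 0"
      using P_P_Suc_at_1[of "n - 1"] elim by auto
    then have "?u * ?v \<noteq> 0"
      using low up pos by auto
    moreover have "(\<beta> n * R n * R (n - 1)) * (?u * ?v) =
        ((real n - 2 * t * \<beta> n) * (real n + 2 * \<alpha> - 2 * t * \<beta> n)) * (?u * ?v)"
      using low up by algebra
    ultimately show ?case by simp
  qed
qed

end

section \<open>Expansions in inverse powers\<close>

text \<open>Expansions in powers of \<open>1 / n\<close> up to an error of order \<open>N\<close> are carried by polynomials whose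
  coefficients of index at least \<open>N\<close> are arbitrary. Arithmetic on expansions then is plain polynomial
  arithmetic, with no truncation.\<close>

definition inverse_power_approx :: "nat \<Rightarrow> (nat \<Rightarrow> real) \<Rightarrow> real poly \<Rightarrow> bool" where
  "inverse_power_approx N f p \<longleftrightarrow> (\<lambda>n. f n - poly p (1 / real n)) \<in> O(\<lambda>n. 1 / real n ^ N)"

lemma inverse_tendsto_0: "(\<lambda>n. 1 / real n) \<longlonglongrightarrow> 0"
  by (rule lim_1_over_n)

lemma tendsto_imp_bigo: "f \<longlonglongrightarrow> (c :: real) \<Longrightarrow> f \<in> O(\<lambda>_. 1)"
  by (rule bigoI_tendsto[where c = c]) simp_all

lemma bigo_eventually_eq:
  fixes f g :: "nat \<Rightarrow> real"
  assumes "f \<in> O(F)" "eventually (\<lambda>n. f n = g n) sequentially"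
  shows "g \<in> O(F)"
  using assms(1) unfolding landau_o.big.in_cong[OF assms(2)] .

lemma bigo_inverse_imp_tendsto_0:
  assumes "f \<in> O(\<lambda>n. 1 / real n)"
  shows "f \<longlonglongrightarrow> 0"
proof -
  obtain C where "eventually (\<lambda>n. norm (f n) \<le> C * norm (1 / real n)) sequentially"
    using assms by (elim landau_o.bigE)
  then have "eventually (\<lambda>n. norm (f n) \<le> norm (1 / real n) * C) sequentially"
    by (simp add: mult.commute)
  with inverse_tendsto_0 show ?thesis
    by (rule tendsto_0_le)
qed

lemma poly_inverse_tendsto: "(\<lambda>n. poly p (1 / real n)) \<longlonglongrightarrow> coeff p 0"
  using tendsto_poly[OF inverse_tendsto_0, of p] by (simp add: poly_0_coeff_0)

lemma poly_inverse_bigo_1: "(\<lambda>n. poly p (1 / real n)) \<in> O(\<lambda>_. 1)"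
  using poly_inverse_tendsto by (rule tendsto_imp_bigo)

lemma inverse_power_bigo_mono: "M \<le> N \<Longrightarrow> (\<lambda>n. 1 / real n ^ N) \<in> O(\<lambda>n. 1 / real n ^ M)"
proof (intro bigoI[of _ 1] eventually_mono[OF eventually_gt_at_top[of 0]])
  fix n :: nat assume "M \<le> N" "n > 0"
  then show "norm (1 / real n ^ N) \<le> 1 * norm (1 / real n ^ M)"
    by (auto intro!: divide_left_mono power_increasing)
qed

lemma approx_bigo_1:
  assumes "inverse_power_approx N f p"
  shows "f \<in> O(\<lambda>_. 1)"
proof -
  have "(\<lambda>n. f n - poly p (1 / real n)) \<in> O(\<lambda>_. 1)"
    using assms inverse_power_bigo_mono[of 0 N] unfolding inverse_power_approx_def
    by (auto intro: landau_o.big_trans)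
  from sum_in_bigo(1)[OF this poly_inverse_bigo_1[of p]] show ?thesis by simp
qed

lemma approx_mono:
  "M \<le> N \<Longrightarrow> inverse_power_approx N f p \<Longrightarrow> inverse_power_approx M f p"
  unfolding inverse_power_approx_def
  using inverse_power_bigo_mono by (rule landau_o.big_trans[rotated])

lemma approx_cong:
  "eventually (\<lambda>n. f n = g n) sequentially \<Longrightarrow>
    inverse_power_approx N f p = inverse_power_approx N g p"
  unfolding inverse_power_approx_def
  by (intro landau_o.big.in_cong) (auto elim: eventually_mono)

lemma approx_poly: "inverse_power_approx N (\<lambda>n. poly p (1 / real n)) p"
  by (simp add: inverse_power_approx_def)

lemma approx_const: "inverse_power_approx N (\<lambda>n. c) [:c:]"
  by (simp add: inverse_power_approx_def)

lemma approx_inverse: "inverse_power_approx N (\<lambda>n. 1 / real n) [:0, 1:]"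
  by (simp add: inverse_power_approx_def)

lemma approx_add:
  assumes "inverse_power_approx N f p" "inverse_power_approx N g q"
  shows "inverse_power_approx N (\<lambda>n. f n + g n) (p + q)"
  using sum_in_bigo(1)[OF assms[unfolded inverse_power_approx_def]]
  by (simp add: inverse_power_approx_def algebra_simps)

lemma approx_diff:
  assumes "inverse_power_approx N f p" "inverse_power_approx N g q"
  shows "inverse_power_approx N (\<lambda>n. f n - g n) (p - q)"
  using sum_in_bigo(2)[OF assms[unfolded inverse_power_approx_def]]
  by (simp add: inverse_power_approx_def algebra_simps)

lemma approx_mult:
  assumes "inverse_power_approx N f p" "inverse_power_approx N g q"
  shows "inverse_power_approx N (\<lambda>n. f n * g n) (p * q)"
proof -
  have "(\<lambda>n. (f n - poly p (1 / n)) * g n) \<in> O(\<lambda>n. 1 / real n ^ N * 1)"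
    using assms(1) approx_bigo_1[OF assms(2)] unfolding inverse_power_approx_def
    by (rule landau_o.big.mult)
  moreover have "(\<lambda>n. (g n - poly q (1 / n)) * poly p (1 / n)) \<in> O(\<lambda>n. 1 / real n ^ N * 1)"
    using assms(2) poly_inverse_bigo_1 unfolding inverse_power_approx_def
    by (rule landau_o.big.mult)
  ultimately have "(\<lambda>n. (f n - poly p (1 / n)) * g n + (g n - poly q (1 / n)) * poly p (1 / n))
      \<in> O(\<lambda>n. 1 / real n ^ N)"
    by (intro sum_in_bigo) simp_all
  then show ?thesis
    by (simp add: inverse_power_approx_def algebra_simps)
qed

lemma approx_smult:
  "inverse_power_approx N f p \<Longrightarrow> inverse_power_approx N (\<lambda>n. c * f n) (smult c p)"
  using approx_mult[OF approx_const, of N f p c] by simp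

text \<open>Division by \<open>n\<close> gains one order of accuracy; this is the only source of progress in the
  bootstrap argument below.\<close>

lemma approx_shift_degree:
  assumes "inverse_power_approx N f p"
  shows "inverse_power_approx (Suc N) (\<lambda>n. f n * (1 / real n)) (pCons 0 p)"
proof -
  have "(\<lambda>n. (f n - poly p (1 / n)) * (1 / real n)) \<in> O(\<lambda>n. 1 / real n ^ N * (1 / real n))"
    using assms unfolding inverse_power_approx_def by (rule landau_o.big.mult) simp
  then show ?thesis
    by (simp add: inverse_power_approx_def algebra_simps)
qed

lemma poly_inverse_bigo:
  assumes "\<And>k. k < N \<Longrightarrow> coeff p k = 0"
  shows "(\<lambda>n. poly p (1 / real n)) \<in> O(\<lambda>n. 1 / real n ^ N)"
proof -
  have "monom 1 N dvd p"
    using assms by (simp add: monom_1_dvd_iff')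
  then obtain r where r: "p = monom 1 N * r" ..
  have "(\<lambda>n. 1 / real n ^ N * poly r (1 / real n)) \<in> O(\<lambda>n. 1 / real n ^ N * 1)"
    by (intro landau_o.big.mult poly_inverse_bigo_1) simp
  then show ?thesis
    by (simp add: r poly_monom power_one_over)
qed

lemma approx_poly_cong:
  assumes "inverse_power_approx N f p" "\<And>k. k < N \<Longrightarrow> coeff p k = coeff q k"
  shows "inverse_power_approx N f q"
proof -
  have "(\<lambda>n. poly (p - q) (1 / real n)) \<in> O(\<lambda>n. 1 / real n ^ N)"
    using assms(2) by (intro poly_inverse_bigo) simp
  from sum_in_bigo(1)[OF assms(1)[unfolded inverse_power_approx_def] this] show ?thesis
    by (simp add: inverse_power_approx_def)
qed

text \<open>If the coefficients first differ at index \<open>k\<close>, then the difference of the two polynomials, multiplied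
  by \<open>n ^ k\<close>, tends to the nonzero difference of these coefficients, although it is \<open>O (1 / n)\<close>.\<close>

lemma approx_unique:
  assumes "inverse_power_approx N f p" "inverse_power_approx N f q" "k < N"
  shows "coeff p k = coeff q k"
proof -
  let ?d = "p - q"
  have bigo: "(\<lambda>n. poly ?d (1 / real n)) \<in> O(\<lambda>n. 1 / real n ^ N)"
    using sum_in_bigo(2)[OF assms(2,1)[unfolded inverse_power_approx_def]] by simp
  have "coeff ?d k = 0"
    using \<open>k < N\<close>
  proof (induction k rule: less_induct)
    case (less k)
    then have "monom 1 k dvd ?d"
      unfolding monom_1_dvd_iff' by (metis order.strict_trans)
    then obtain r where r: "?d = monom 1 k * r" ..
    have "(\<lambda>n. real n ^ k * poly ?d (1 / real n)) \<in> O(\<lambda>n. real n ^ k * (1 / real n ^ N))"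
      using bigo by (intro landau_o.big.mult) simp_all
    also have "(\<lambda>n. real n ^ k * (1 / real n ^ N)) \<in> O(\<lambda>n. 1 / real n)"
    proof (intro bigoI[of _ 1] eventually_mono[OF eventually_gt_at_top[of 0]])
      fix n :: nat assume "n > 0"
      moreover have "real n ^ N = real n ^ k * real n ^ (N - k)"
        using less.prems by (simp flip: power_add)
      moreover have "real n ^ 1 \<le> real n ^ (N - k)"
        using less.prems \<open>n > 0\<close> by (intro power_increasing) auto
      ultimately show "norm (real n ^ k * (1 / real n ^ N)) \<le> 1 * norm (1 / real n)"
        by (simp add: field_simps)
    qed
    finally have "(\<lambda>n. real n ^ k * poly ?d (1 / real n)) \<in> O(\<lambda>n. 1 / real n)" .
    moreover have "eventually (\<lambda>n. real n ^ k * poly ?d (1 / real n) = poly r (1 / real n)) sequentially"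
      using eventually_gt_at_top[of 0]
      by eventually_elim (simp add: r poly_monom power_one_over del: poly_diff)
    ultimately have "(\<lambda>n. poly r (1 / real n)) \<in> O(\<lambda>n. 1 / real n)"
      by (rule bigo_eventually_eq)
    then have "(\<lambda>n. poly r (1 / real n)) \<longlonglongrightarrow> 0"
      by (rule bigo_inverse_imp_tendsto_0)
    with poly_inverse_tendsto have "coeff r 0 = 0"
      using LIMSEQ_unique by blast
    then show ?case
      by (simp add: r coeff_monom_mult del: coeff_diff)
  qed
  then show ?thesis by simp
qed

lemma truncated_poly_inverse:
  fixes p :: "'a :: field poly"
  assumes "coeff p 0 \<noteq> 0"
  shows "\<exists>q r. p * q = 1 + monom 1 N * r"
proof (induction N)
  case 0
  have "p * 0 = 1 + monom 1 0 * (-1)" by (simp add: monom_0 flip: one_pCons)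
  then show ?case by blast
next
  case (Suc N)
  then obtain q r where qr: "p * q = 1 + monom 1 N * r" by blast
  define c where "c = coeff r 0 / coeff p 0"
  have "coeff (r - smult c p) 0 = 0"
    using assms by (simp add: c_def)
  then obtain s where s: "r - smult c p = pCons 0 s"
    by (cases "r - smult c p") auto
  have monom_c: "monom c N = smult c (monom 1 N)"
    by (simp add: smult_monom)
  have "p * (q - monom c N) = 1 + monom 1 N * (r - smult c p)"
    by (simp add: monom_c qr right_diff_distrib mult.commute)
  also have "\<dots> = 1 + monom 1 (Suc N) * s"
    by (simp add: s monom_Suc)
  finally show ?case by blast
qed

text \<open>The polynomial for the reciprocal is an inverse of \<open>q\<close> modulo \<open>X ^ N\<close>.\<close>

lemma approx_divide:
  assumes "inverse_power_approx N f p" "inverse_power_approx N g q" "N > 0" "coeff q 0 \<noteq> 0"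
  shows "\<exists>r. inverse_power_approx N (\<lambda>n. f n / g n) r"
proof -
  obtain u v where uv: "q * u = 1 + monom 1 N * v"
    using truncated_poly_inverse[OF assms(4)] by blast
  have "inverse_power_approx 1 g q"
    using assms(2,3) by (intro approx_mono[of 1 N]) auto
  then have "(\<lambda>n. g n - poly q (1 / real n)) \<longlonglongrightarrow> 0"
    unfolding inverse_power_approx_def by (simp add: bigo_inverse_imp_tendsto_0)
  from tendsto_add[OF this poly_inverse_tendsto[of q]] have lim: "g \<longlonglongrightarrow> coeff q 0"
    by simp
  then have inv: "(\<lambda>n. inverse (g n)) \<in> O(\<lambda>_. 1)"
    using tendsto_imp_bigo[OF tendsto_inverse[OF lim assms(4)]] by simp
  have nz: "eventually (\<lambda>n. g n \<noteq> 0) sequentially"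
    using tendsto_imp_eventually_ne[OF lim assms(4)] .
  have "inverse_power_approx N (\<lambda>n. g n * poly u (1 / real n)) (q * u)"
    by (intro approx_mult assms approx_poly)
  then have "inverse_power_approx N (\<lambda>n. g n * poly u (1 / real n)) 1"
    by (rule approx_poly_cong) (simp add: uv coeff_monom_mult)
  then have "(\<lambda>n. inverse (g n) * (g n * poly u (1 / real n) - 1)) \<in> O(\<lambda>n. 1 * (1 / real n ^ N))"
    unfolding inverse_power_approx_def by (intro landau_o.big.mult inv) simp
  moreover have "eventually (\<lambda>n. inverse (g n) * (g n * poly u (1 / real n) - 1)
      = poly u (1 / real n) - inverse (g n)) sequentially"
    using nz by eventually_elim (simp add: field_simps)
  ultimately have "(\<lambda>n. poly u (1 / real n) - inverse (g n)) \<in> O(\<lambda>n. 1 / real n ^ N)"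
    by (simp add: bigo_eventually_eq)
  then have "inverse_power_approx N (\<lambda>n. inverse (g n)) u"
    unfolding inverse_power_approx_def by (subst (asm) landau_o.big.uminus_in_iff[symmetric]) simp
  from approx_mult[OF assms(1) this] show ?thesis
    by (auto simp: divide_inverse)
qed

lemma approx_pcompose:
  assumes "inverse_power_approx N f q"
  shows "inverse_power_approx N (\<lambda>n. poly p (f n)) (pcompose p q)"
proof (induction p)
  case 0
  then show ?case using approx_const[of N 0] by simp
next
  case (pCons a p)
  from approx_add[OF approx_const approx_mult[OF assms pCons.IH], of a] show ?case
    by (simp add: pcompose_pCons)
qed

text \<open>The expansion of \<open>1 / (n + c)\<close>: with \<open>u = 1 / (n + c)\<close> and \<open>x = 1 / n\<close> one has \<open>u = x - c u x\<close>, and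
  each use of this identity gains one order.\<close>

primrec shift_poly :: "real \<Rightarrow> nat \<Rightarrow> real poly" where
  "shift_poly c 0 = 0"
| "shift_poly c (Suc N) = [:0, 1:] - smult c (pCons 0 (shift_poly c N))"

lemma approx_shift_index:
  assumes "inverse_power_approx N f p"
    and s: "eventually (\<lambda>n. real (s n) = real n + c) sequentially"
  shows "inverse_power_approx N (\<lambda>n. f (s n)) (pcompose p (shift_poly c N))"
proof -
  have "filterlim (\<lambda>n. real n + c) at_top sequentially"
    by real_asymp
  then have "filterlim (\<lambda>n. real (s n)) at_top sequentially"
    using filterlim_cong[OF refl refl s] by blast
  then have "filterlim s at_top sequentially"
    unfolding filterlim_at_top
  proof (intro allI)
    fix Z :: nat
    assume "\<forall>Z. eventually (\<lambda>n. Z \<le> real (s n)) sequentially"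
    then have "eventually (\<lambda>n. real Z \<le> real (s n)) sequentially" by blast
    then show "eventually (\<lambda>n. Z \<le> s n) sequentially" by simp
  qed
  then have remainder: "(\<lambda>n. f (s n) - poly p (1 / real (s n))) \<in> O(\<lambda>n. 1 / real (s n) ^ N)"
    using landau_o.big.compose assms(1) unfolding inverse_power_approx_def by fast
  have "(\<lambda>n. 1 / (real n + c)) \<in> O(\<lambda>n. 1 / real n)"
    by real_asymp
  moreover have "eventually (\<lambda>n. 1 / (real n + c) = 1 / real (s n)) sequentially"
    using s by eventually_elim simp
  ultimately have inverse_bigo: "(\<lambda>n. 1 / real (s n)) \<in> O(\<lambda>n. 1 / real n)"
    by (rule bigo_eventually_eq)
  have q: "inverse_power_approx N (\<lambda>n. 1 / real (s n)) (shift_poly c N)"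
  proof (induction N)
    case 0
    have "(\<lambda>n. 1 / real n) \<in> O(\<lambda>_. 1)"
      using inverse_power_bigo_mono[of 0 1] by simp
    with inverse_bigo have "(\<lambda>n. 1 / real (s n)) \<in> O(\<lambda>_. 1)"
      by (rule landau_o.big_trans)
    then show ?case by (simp add: inverse_power_approx_def)
  next
    case (Suc N)
    have "inverse_power_approx (Suc N) (\<lambda>n. 1 / real n - c * (1 / real (s n) * (1 / real n)))
        (shift_poly c (Suc N))"
      unfolding shift_poly.simps
      by (intro approx_diff approx_inverse approx_smult approx_shift_degree Suc.IH)
    moreover have "eventually (\<lambda>n. 1 / real n - c * (1 / real (s n) * (1 / real n)) = 1 / real (s n))
        sequentially"
      using s eventually_gt_at_top[of "nat \<lceil>\<bar>c\<bar>\<rceil>"]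
    proof eventually_elim
      case (elim n)
      then have "real n > 0" "real n + c > 0" by linarith+
      with elim(1) show ?case by (simp add: divide_simps)
    qed
    ultimately show ?case
      by (simp add: approx_cong)
  qed
  from landau_o.big_power[OF inverse_bigo, of N]
  have "(\<lambda>n. 1 / real (s n) ^ N) \<in> O(\<lambda>n. 1 / real n ^ N)"
    by (simp add: power_one_over)
  with remainder have "(\<lambda>n. f (s n) - poly p (1 / real (s n))) \<in> O(\<lambda>n. 1 / real n ^ N)"
    by (rule landau_o.big_trans)
  then have "inverse_power_approx N (\<lambda>n. f (s n) - poly p (1 / real (s n))) 0"
    by (simp add: inverse_power_approx_def)
  from approx_add[OF this approx_pcompose[OF q, of p]] show ?thesis
    by simp
qed

text \<open>Approximations of all orders fit together to one coefficient sequence, because each coefficient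
  is already determined by any approximation of higher order.\<close>

lemma inverse_power_expansion_exists:
  assumes "\<And>N. \<exists>p. inverse_power_approx N f p"
  obtains a where "has_inverse_power_expansion f (a 0) a"
    and "\<And>N. inverse_power_approx N f (\<Sum>j<N. monom (a j) j)"
proof -
  obtain p where p: "\<And>N. inverse_power_approx N f (p N)"
    using assms by metis
  define a where "a j = coeff (p (Suc j)) j" for j
  have approx: "inverse_power_approx N f (\<Sum>j<N. monom (a j) j)" for N
  proof (rule approx_poly_cong[OF p])
    fix k assume "k < N"
    then have "coeff (p N) k = a k"
      unfolding a_def by (intro approx_unique[OF approx_mono[OF _ p] p]) auto
    then show "coeff (p N) k = coeff (\<Sum>j<N. monom (a j) j) k"
      using \<open>k < N\<close> by (simp add: coeff_sum)
  qed
  have "has_inverse_power_expansion f (a 0) a"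
    unfolding has_inverse_power_expansion_def
  proof (intro allI impI)
    fix N :: nat
    have "poly (\<Sum>j<N + 1. monom (a j) j) (1 / real n) = a 0 + (\<Sum>j=1..N. a j / real n ^ j)" for n
    proof -
      have "{..<N + 1} = insert 0 {1..N}" by auto
      then show ?thesis by (simp add: poly_sum poly_monom divide_inverse power_inverse)
    qed
    then show "(\<lambda>n. f n - (a 0 + (\<Sum>j=1..N. a j / real n ^ j))) \<in> O(\<lambda>n. 1 / real n ^ (N + 1))"
      using approx[of "N + 1"] by (simp only: inverse_power_approx_def)
  qed
  then show thesis
    using approx by (rule that)
qed

section \<open>Expansion of bounded solutions of the string equation\<close>

text \<open>The terms \<open>a\<^sub>j / (n + c)\<^sup>j\<close>, expanded by the binomial series and collected by powers of \<open>1 / n\<close>.\<close>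

lemma coeff_shifted:
  fixes a0 a1 a2 a3 a4 a5 c :: real
  defines "q \<equiv> pcompose [:a0, a1, a2, a3, a4, a5:] (shift_poly c 6)"
  shows "coeff q 0 = a0"
    "coeff q 1 = a1"
    "coeff q 2 = a2 - c * a1"
    "coeff q 3 = a3 - 2 * c * a2 + c^2 * a1"
    "coeff q 4 = a4 - 3 * c * a3 + 3 * c^2 * a2 - c^3 * a1"
    "coeff q 5 = a5 - 4 * c * a4 + 6 * c^2 * a3 - 4 * c^3 * a2 + c^4 * a1"
  unfolding q_def
  by (simp_all add: pcompose_pCons numeral_eq_Suc algebra_simps)

text \<open>The asymptotics depend on nothing but boundedness and the string equation. Division by \<open>n\<^sup>2\<close> turns
  the four factors other than \<open>b n\<close> into quantities that involve the sequence only with weight \<open>1 / n\<close>.\<close>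

locale string_equation_solution =
  fixes \<alpha> t :: real and b :: "nat \<Rightarrow> real"
  assumes bounded: "b \<in> O(\<lambda>_. 1)"
    and equation: "eventually (\<lambda>n.
      b n * (2 * n + 1 + 2 * \<alpha> - 2 * t * (b (Suc n) + b n))
          * (2 * n - 1 + 2 * \<alpha> - 2 * t * (b n + b (n - 1)))
      = (real n - 2 * t * b n) * (real n + 2 * \<alpha> - 2 * t * b n)) sequentially"
begin

definition R_scaled :: "nat \<Rightarrow> real" where
  "R_scaled n = (2 + (1 + 2 * \<alpha>) * (1 / n)) - 2 * t * ((b (Suc n) + b n) * (1 / n))"

definition R_pred_scaled :: "nat \<Rightarrow> real" where
  "R_pred_scaled n = (2 + (2 * \<alpha> - 1) * (1 / n)) - 2 * t * ((b n + b (n - 1)) * (1 / n))"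

definition lowering_scaled :: "nat \<Rightarrow> real" where
  "lowering_scaled n = 1 - 2 * t * (b n * (1 / n))"

definition raising_scaled :: "nat \<Rightarrow> real" where
  "raising_scaled n = (1 + 2 * \<alpha> * (1 / n)) - 2 * t * (b n * (1 / n))"

lemma scaled_equation: "eventually (\<lambda>n. b n * (R_scaled n * R_pred_scaled n) = lowering_scaled n * raising_scaled n) sequentially"
  using equation eventually_gt_at_top[of 0]
proof eventually_elim
  case (elim n)
  have "R_scaled n = (2 * n + 1 + 2 * \<alpha> - 2 * t * (b (Suc n) + b n)) / n"
    "R_pred_scaled n = (2 * n - 1 + 2 * \<alpha> - 2 * t * (b n + b (n - 1))) / n"
    "lowering_scaled n = (real n - 2 * t * b n) / n" "raising_scaled n = (real n + 2 * \<alpha> - 2 * t * b n) / n"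
    using elim(2) by (simp_all add: R_scaled_def R_pred_scaled_def lowering_scaled_def raising_scaled_def field_simps)
  with elim show ?case
    by (simp add: mult.assoc)
qed

lemma approx_factors:
  assumes b: "inverse_power_approx N b p"
  defines "p' \<equiv> pcompose p (shift_poly 1 N)" and "p'' \<equiv> pcompose p (shift_poly (-1) N)"
  shows "inverse_power_approx (Suc N) R_scaled (([:2, 1 + 2 * \<alpha>:]) - smult (2 * t) (pCons 0 (p' + p)))"
    and "inverse_power_approx (Suc N) R_pred_scaled (([:2, 2 * \<alpha> - 1:]) - smult (2 * t) (pCons 0 (p + p'')))"
    and "inverse_power_approx (Suc N) lowering_scaled ([:1:] - smult (2 * t) (pCons 0 p))"
    and "inverse_power_approx (Suc N) raising_scaled ([:1, 2 * \<alpha>:] - smult (2 * t) (pCons 0 p))"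
proof -
  have linear: "inverse_power_approx (Suc N) (\<lambda>n. c + d * (1 / real n)) [:c, d:]" for c d
    using approx_poly[of "Suc N" "[:c, d:]"] by (simp add: mult.commute)
  have b_Suc: "inverse_power_approx N (\<lambda>n. b (Suc n)) p'"
    unfolding p'_def by (intro approx_shift_index b) simp
  have "eventually (\<lambda>n. real (n - 1) = real n + (-1)) sequentially"
    using eventually_ge_at_top[of 1] by eventually_elim (simp add: of_nat_diff)
  from approx_shift_index[OF b this] have b_pred: "inverse_power_approx N (\<lambda>n. b (n - 1)) p''"
    unfolding p''_def .
  show "inverse_power_approx (Suc N) R_scaled (([:2, 1 + 2 * \<alpha>:]) - smult (2 * t) (pCons 0 (p' + p)))"
    unfolding R_scaled_def[abs_def]
    by (intro approx_diff approx_smult approx_shift_degree approx_add b b_Suc linear)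
  show "inverse_power_approx (Suc N) R_pred_scaled (([:2, 2 * \<alpha> - 1:]) - smult (2 * t) (pCons 0 (p + p'')))"
    unfolding R_pred_scaled_def[abs_def]
    by (intro approx_diff approx_smult approx_shift_degree approx_add b b_pred linear)
  show "inverse_power_approx (Suc N) lowering_scaled ([:1:] - smult (2 * t) (pCons 0 p))"
    unfolding lowering_scaled_def[abs_def]
    by (intro approx_diff approx_smult approx_shift_degree approx_const b)
  show "inverse_power_approx (Suc N) raising_scaled ([:1, 2 * \<alpha>:] - smult (2 * t) (pCons 0 p))"
    unfolding raising_scaled_def[abs_def]
    by (intro approx_diff approx_smult approx_shift_degree b linear)
qed

text \<open>Bootstrap: solve the scaled equation for \<open>b n\<close>. The right-hand side involves the sequence only
  through \<open>b / n\<close>, so an expansion with error of order \<open>N\<close> on the right yields one of order \<open>N + 1\<close>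
  on the left. The induction starts from boundedness, and the denominator \<open>R_scaled n * R_pred_scaled n\<close> tends to 4.\<close>

lemma approx_exists: "\<exists>p. inverse_power_approx N b p"
proof (induction N)
  case 0
  have "inverse_power_approx 0 b 0"
    using bounded by (simp add: inverse_power_approx_def)
  then show ?case ..
next
  case (Suc N)
  then obtain p where p: "inverse_power_approx N b p" ..
  note factors = approx_factors[OF p]
  note D = approx_mult[OF factors(1,2)] and N = approx_mult[OF factors(3,4)]
  obtain r where r: "inverse_power_approx (Suc N) (\<lambda>n. (lowering_scaled n * raising_scaled n) / (R_scaled n * R_pred_scaled n)) r"
    using approx_divide[OF N D] by (auto simp: coeff_mult)
  have "inverse_power_approx (Suc 0) (\<lambda>n. R_scaled n * R_pred_scaled n) [:4:]"
    by (rule approx_poly_cong[OF approx_mono[OF _ D]]) (auto simp: coeff_mult)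
  then have "(\<lambda>n. R_scaled n * R_pred_scaled n - 4) \<longlonglongrightarrow> 0"
    unfolding inverse_power_approx_def by (simp add: bigo_inverse_imp_tendsto_0)
  then have "(\<lambda>n. R_scaled n * R_pred_scaled n) \<longlonglongrightarrow> 4"
    by (simp add: LIM_zero_iff)
  then have "eventually (\<lambda>n. R_scaled n * R_pred_scaled n \<noteq> 0) sequentially"
    by (rule tendsto_imp_eventually_ne) simp
  then have "eventually (\<lambda>n. (lowering_scaled n * raising_scaled n) / (R_scaled n * R_pred_scaled n) = b n) sequentially"
    using scaled_equation by eventually_elim (metis nonzero_mult_div_cancel_right)
  from r[unfolded approx_cong[OF this]] show ?case
    by blast
qed

text \<open>By uniqueness, both sides of the scaled equation have the same coefficients. The coefficient of
  index \<open>k\<close> is \<open>4 * coeff p k\<close> plus an expression in the coefficients of lower index, so the values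
  are determined one after the other.\<close>

lemma coefficients:
  assumes p: "inverse_power_approx 7 b p"
  shows "coeff p 0 = 1 / 4"
    and "coeff p 1 = 0"
    and "coeff p 2 = 1 / 16 * (1 - 4 * \<alpha>^2)"
    and "coeff p 3 = 1 / 16 * (1 - 4 * \<alpha>^2) * (t - 2 * \<alpha>)"
    and "coeff p 4 = 1 / 64 * (1 - 4 * \<alpha>^2) * (3 * t^2 - 12 * \<alpha> * t + 12 * \<alpha>^2 + 1)"
    and "coeff p 5 = 1 / 64 * (1 - 4 * \<alpha>^2) *
      (2 * t^3 - 12 * \<alpha> * t^2 + (11 + 20 * \<alpha>^2) * t - 4 * \<alpha> * (1 + 4 * \<alpha>^2))"
    and "coeff p 6 = 1 / 256 * (1 - 4 * \<alpha>^2) *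
      (5 * t^4 - 40 * \<alpha> * t^3 + 20 * (5 + 4 * \<alpha>^2) * t^2
        - 20 * \<alpha> * (11 + 4 * \<alpha>^2) * t + 80 * \<alpha>^4 + 40 * \<alpha>^2 + 1)"
proof -
  \<comment> \<open>Inside the factors the expansion is multiplied by \<open>1 / n\<close>, hence only its first six terms matter.\<close>
  define q where "q = [:coeff p 0, coeff p 1, coeff p 2, coeff p 3, coeff p 4, coeff p 5:]"
  have coeff_q: "coeff q k = coeff p k" if "k < 6" for k
  proof -
    have "k \<in> {0, 1, 2, 3, 4, 5}" using that by auto
    then show ?thesis by (auto simp: q_def numeral_eq_Suc)
  qed
  have q: "inverse_power_approx 6 b q"
    by (rule approx_poly_cong[OF approx_mono[OF _ p]]) (simp_all add: coeff_q)
  define q' where "q' = pcompose q (shift_poly 1 6)"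
  define q'' where "q'' = pcompose q (shift_poly (-1) 6)"
  note q' = coeff_shifted[where c = 1, of "coeff p 0" "coeff p 1" "coeff p 2" "coeff p 3"
      "coeff p 4" "coeff p 5", folded q_def, folded q'_def]
  note q'' = coeff_shifted[where c = "-1", of "coeff p 0" "coeff p 1" "coeff p 2" "coeff p 3"
      "coeff p 4" "coeff p 5", folded q_def, folded q''_def]
  define d where "d = [:2, 1 + 2 * \<alpha>:] - smult (2 * t) (pCons 0 (q' + q))"
  define e where "e = [:2, 2 * \<alpha> - 1:] - smult (2 * t) (pCons 0 (q + q''))"
  define u where "u = [:1:] - smult (2 * t) (pCons 0 q)"
  define v where "v = [:1, 2 * \<alpha>:] - smult (2 * t) (pCons 0 q)"
  have "Suc 6 = (7 :: nat)" by simp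
  note factors = approx_factors[OF q, unfolded this, folded q'_def q''_def, folded d_def e_def u_def v_def]
  have "inverse_power_approx 7 (\<lambda>n. lowering_scaled n * raising_scaled n) (p * (d * e))"
    using approx_mult[OF p approx_mult[OF factors(1,2)]] unfolding approx_cong[OF scaled_equation] .
  from approx_unique[OF this approx_mult[OF factors(3,4)]]
  have compare: "coeff (p * (d * e)) k = coeff (u * v) k" if "k < 7" for k
    using that .
  have conv: "coeff (f * g) 0 = coeff f 0 * coeff g 0"
    "coeff (f * g) 1 = coeff f 0 * coeff g 1 + coeff f 1 * coeff g 0"
    "coeff (f * g) 2 = coeff f 0 * coeff g 2 + coeff f 1 * coeff g 1 + coeff f 2 * coeff g 0"
    "coeff (f * g) 3 = coeff f 0 * coeff g 3 + coeff f 1 * coeff g 2 + coeff f 2 * coeff g 1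
      + coeff f 3 * coeff g 0"
    "coeff (f * g) 4 = coeff f 0 * coeff g 4 + coeff f 1 * coeff g 3 + coeff f 2 * coeff g 2
      + coeff f 3 * coeff g 1 + coeff f 4 * coeff g 0"
    "coeff (f * g) 5 = coeff f 0 * coeff g 5 + coeff f 1 * coeff g 4 + coeff f 2 * coeff g 3
      + coeff f 3 * coeff g 2 + coeff f 4 * coeff g 1 + coeff f 5 * coeff g 0"
    "coeff (f * g) 6 = coeff f 0 * coeff g 6 + coeff f 1 * coeff g 5 + coeff f 2 * coeff g 4
      + coeff f 3 * coeff g 3 + coeff f 4 * coeff g 2 + coeff f 5 * coeff g 1 + coeff f 6 * coeff g 0"
    for f g :: "real poly"
    by (simp_all add: coeff_mult numeral_eq_Suc)
  have coeff_linear: "coeff ([:x, y:] - smult (2 * t) (pCons 0 f)) 0 = x"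
    "coeff ([:x, y:] - smult (2 * t) (pCons 0 f)) 1 = y - 2 * t * coeff f 0"
    "coeff ([:x, y:] - smult (2 * t) (pCons 0 f)) 2 = - 2 * t * coeff f 1"
    "coeff ([:x, y:] - smult (2 * t) (pCons 0 f)) 3 = - 2 * t * coeff f 2"
    "coeff ([:x, y:] - smult (2 * t) (pCons 0 f)) 4 = - 2 * t * coeff f 3"
    "coeff ([:x, y:] - smult (2 * t) (pCons 0 f)) 5 = - 2 * t * coeff f 4"
    "coeff ([:x, y:] - smult (2 * t) (pCons 0 f)) 6 = - 2 * t * coeff f 5"
    for x y f
    by (simp_all add: numeral_eq_Suc)
  have u_eq: "u = [:1, 0:] - smult (2 * t) (pCons 0 q)"
    by (simp add: u_def)
  \<comment> \<open>Explicit formulas reduce every comparison to arithmetic in \<open>\<alpha>\<close> and \<open>t\<close>; the second linear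
    coefficient of \<open>u\<close> is written as 0 to fit the common shape.\<close>
  note expand = conv coeff_linear[where f = "q' + q" and x = 2 and y = "1 + 2 * \<alpha>", folded d_def]
    coeff_linear[where f = "q + q''" and x = 2 and y = "2 * \<alpha> - 1", folded e_def]
    coeff_linear[where f = q and x = 1 and y = 0, folded u_eq]
    coeff_linear[where f = q and x = 1 and y = "2 * \<alpha>", folded v_def]
    coeff_add q' q'' coeff_q
  show a0: "coeff p 0 = 1 / 4"
    using compare[of 0] by (simp add: expand)
  show a1: "coeff p 1 = 0"
    using compare[of 1] by (simp add: expand a0 field_simps del: One_nat_def)
  show a2: "coeff p 2 = 1 / 16 * (1 - 4 * \<alpha>^2)"
    using compare[of 2]
    by (simp add: expand a0 a1 del: One_nat_def) (simp add: field_simps power_numeral_even power_numeral_odd)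
  show a3: "coeff p 3 = 1 / 16 * (1 - 4 * \<alpha>^2) * (t - 2 * \<alpha>)"
    using compare[of 3]
    by (simp add: expand a0 a1 a2 del: One_nat_def) (simp add: field_simps power_numeral_even power_numeral_odd)
  show a4: "coeff p 4 = 1 / 64 * (1 - 4 * \<alpha>^2) * (3 * t^2 - 12 * \<alpha> * t + 12 * \<alpha>^2 + 1)"
    using compare[of 4]
    by (simp add: expand a0 a1 a2 a3 del: One_nat_def) (simp add: field_simps power_numeral_even power_numeral_odd)
  show a5: "coeff p 5 = 1 / 64 * (1 - 4 * \<alpha>^2) *
      (2 * t^3 - 12 * \<alpha> * t^2 + (11 + 20 * \<alpha>^2) * t - 4 * \<alpha> * (1 + 4 * \<alpha>^2))"
    using compare[of 5]
    by (simp add: expand a0 a1 a2 a3 a4 del: One_nat_def) (simp add: field_simps power_numeral_even power_numeral_odd)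
  show a6: "coeff p 6 = 1 / 256 * (1 - 4 * \<alpha>^2) *
      (5 * t^4 - 40 * \<alpha> * t^3 + 20 * (5 + 4 * \<alpha>^2) * t^2
        - 20 * \<alpha> * (11 + 4 * \<alpha>^2) * t + 80 * \<alpha>^4 + 40 * \<alpha>^2 + 1)"
    using compare[of 6]
    by (simp add: expand a0 a1 a2 a3 a4 a5 del: One_nat_def) (simp add: field_simps power_numeral_even power_numeral_odd)
qed

end

section \<open>The recurrence coefficients of the weight\<close>

theorem theorem3p1:
  fixes \<alpha> t :: real and P :: "nat \<Rightarrow> real poly" and h \<beta> :: "nat \<Rightarrow> real"
  assumes "\<alpha> > -1"
    and "monic_orthogonal_polys \<alpha> t P h"
    and "recurrence_coeffs P \<beta>"
  shows "\<exists>a :: nat \<Rightarrow> real.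
    has_inverse_power_expansion \<beta> (1 / 4) a \<and>
    a 1 = 0 \<and>
    a 2 = 1 / 16 * (1 - 4 * \<alpha>^2) \<and>
    a 3 = 1 / 16 * (1 - 4 * \<alpha>^2) * (t - 2 * \<alpha>) \<and>
    a 4 = 1 / 64 * (1 - 4 * \<alpha>^2) * (3 * t^2 - 12 * \<alpha> * t + 12 * \<alpha>^2 + 1) \<and>
    a 5 = 1 / 64 * (1 - 4 * \<alpha>^2) *
      (2 * t^3 - 12 * \<alpha> * t^2 + (11 + 20 * \<alpha>^2) * t - 4 * \<alpha> * (1 + 4 * \<alpha>^2)) \<and>
    a 6 = 1 / 256 * (1 - 4 * \<alpha>^2) *
      (5 * t^4 - 40 * \<alpha> * t^3 + 20 * (5 + 4 * \<alpha>^2) * t^2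
        - 20 * \<alpha> * (11 + 4 * \<alpha>^2) * t + 80 * \<alpha>^4 + 40 * \<alpha>^2 + 1)"
proof -
  interpret weighted_orthogonal_polys \<alpha> t P h \<beta>
    using assms by unfold_locales
  interpret string_equation_solution \<alpha> t \<beta>
  proof
    show "\<beta> \<in> O(\<lambda>_. 1)"
    proof (intro bigoI[of _ 1] eventually_mono[OF eventually_ge_at_top[of 2]])
      fix n :: nat assume "n \<ge> 2"
      then obtain m where "n = Suc (Suc m)"
        by (metis add_2_eq_Suc le_Suc_ex)
      then show "norm (\<beta> n) \<le> 1 * norm (1 :: real)"
        using \<beta>_pos[of "Suc m"] \<beta>_le_1[of m] by simp
    qed
    show "eventually (\<lambda>n.
        \<beta> n * (2 * n + 1 + 2 * \<alpha> - 2 * t * (\<beta> (Suc n) + \<beta> n))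
            * (2 * n - 1 + 2 * \<alpha> - 2 * t * (\<beta> n + \<beta> (n - 1)))
        = (real n - 2 * t * \<beta> n) * (real n + 2 * \<alpha> - 2 * t * \<beta> n)) sequentially"
      using eventually_string_equation eventually_gt_at_top[of 0]
      by eventually_elim (simp add: R_def of_nat_diff add_ac)
  qed
  obtain a where a: "has_inverse_power_expansion \<beta> (a 0) a"
    and approx: "\<And>N. inverse_power_approx N \<beta> (\<Sum>j<N. monom (a j) j)"
    using inverse_power_expansion_exists[OF approx_exists] by blast
  have coeff: "coeff (\<Sum>j<7. monom (a j) j) k = a k" if "k < 7" for k
    using that by (simp add: coeff_sum)
  have "a 0 = 1 / 4" "a 1 = 0"
    using coefficients(1,2)[OF approx[of 7]] by (simp_all add: coeff)
  with a show ?thesis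
    using coefficients(3-7)[OF approx[of 7]] by (intro exI[of _ a]) (simp add: coeff)
qed

end
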